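(* A mixed lattice group $G$ does not contain nonzero elements of finite order if one of the following conditions holds. (a) $G_{sp}\subseteq G_p$ and $G$ is $(\leq)$-Archimedean. (b) $G_{p}\subseteq G_{sp}$ and $G$ is $(\preccurlyeq)$-Archimedean. (c) $G$ is a $(\leq)$-Archimedean or $(\preccurlyeq)$-Archimedean mixed lattice group such that the set $G_{sp}\cap G_p$ is generating.
   Context: $\mathbb{N}=\{1,2,3,\dots\}$. A mixed lattice group is an abelian group $(G,+)$ with two partial orders $\leq$ and $\preccurlyeq$, each compatible with addition ($u\leq v$ implies $u+w\leq v+w$, and likewise for $\preccurlyeq$), such that the mixed envelopes $x\curlyvee y=\min\{w\in G: w\succcurlyeq x \text{ and } w\geq y\}$ and $x\curlywedge y=\max\{w\in G: w\preccurlyeq x \text{ and } w\leq y\}$ (minimum and maximum with respect to $\leq$) exist for all $x,y\in G$. Notation: $G_p=\{w\in G: w\geq 0\}$, $G_{sp}=\{w\in G: w\succcurlyeq 0\}$. A sub-semigroup $F\subseteq G$ is generating if $G=F-F$, i.e. every element of $G$ is a difference of two elements of $F$. $G$ is $(\leq)$-Archimedean if, for all $x,y\in G$, $nx\leq y$ for all $n\in\mathbb{N}$ implies $x\leq 0$. $G$ is $(\preccurlyeq)$-Archimedean if, for all $x,y\in G$, $nx\preccurlyeq y$ for all $n\in\mathbb{N}$ implies $x\preccurlyeq 0$. *)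

theory Defs
  imports Main
begin

definition is_minimum :: "('a \<Rightarrow> 'a \<Rightarrow> bool) \<Rightarrow> 'a set \<Rightarrow> 'a \<Rightarrow> bool" where
  "is_minimum r S m \<longleftrightarrow> m \<in> S \<and> (\<forall>s\<in>S. r m s)"

definition is_maximum :: "('a \<Rightarrow> 'a \<Rightarrow> bool) \<Rightarrow> 'a set \<Rightarrow> 'a \<Rightarrow> bool" where
  "is_maximum r S m \<longleftrightarrow> m \<in> S \<and> (\<forall>s\<in>S. r s m)"

definition group_partial_order :: "('a::ab_group_add \<Rightarrow> 'a \<Rightarrow> bool) \<Rightarrow> bool" where
  "group_partial_order r \<longleftrightarrow>
     reflp r \<and> transp r \<and> antisymp r \<and> (\<forall>u v w. r u v \<longrightarrow> r (u + w) (v + w))"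

text \<open>The group is the whole type. The first order is the \<open>\<le>\<close> of the theory and the second
  one is the specific order \<open>\<preceq>\<close>; both are parameters. In either envelope the minimum
  or maximum is taken with respect to the first order.\<close>

locale mixed_lattice_group =
  fixes le :: "'a::ab_group_add \<Rightarrow> 'a \<Rightarrow> bool" (infix "\<^bold>\<le>" 50)
    and sle :: "'a \<Rightarrow> 'a \<Rightarrow> bool" (infix "\<preceq>" 50)
  assumes le_order: "group_partial_order (\<^bold>\<le>)"
    and sle_order: "group_partial_order (\<preceq>)"
    and upper_envelope_exists: "\<exists>m. is_minimum (\<^bold>\<le>) {w. x \<preceq> w \<and> y \<^bold>\<le> w} m"
    and lower_envelope_exists: "\<exists>m. is_maximum (\<^bold>\<le>) {w. w \<preceq> x \<and> w \<^bold>\<le> y} m"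

text \<open>For the two orders this gives \<open>G\<^sub>p\<close> and \<open>G\<^sub>s\<^sub>p\<close> respectively.\<close>

definition positive_cone :: "('a::ab_group_add \<Rightarrow> 'a \<Rightarrow> bool) \<Rightarrow> 'a set" where
  "positive_cone r = {w. r 0 w}"

definition generating :: "'a::ab_group_add set \<Rightarrow> bool" where
  "generating F \<longleftrightarrow> (UNIV :: 'a set) = {u - v |u v. u \<in> F \<and> v \<in> F}"

definition nmult :: "nat \<Rightarrow> 'a::ab_group_add \<Rightarrow> 'a" where
  "nmult n x = (\<Sum>i<n. x)"

definition archimedean :: "('a::ab_group_add \<Rightarrow> 'a \<Rightarrow> bool) \<Rightarrow> bool" where
  "archimedean r \<longleftrightarrow> (\<forall>x y. (\<forall>n\<ge>1. r (nmult n x) y) \<longrightarrow> r x 0)"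

definition has_finite_order :: "'a::ab_group_add \<Rightarrow> bool" where
  "has_finite_order x \<longleftrightarrow> (\<exists>n\<ge>1. nmult n x = 0)"

end

theory Submission
  imports Defs
begin

text \<open>A torsion element \<open>x\<close> has only finitely many distinct multiples. If every two elements of the
  group have a common upper bound for an order \<open>r\<close>, these multiples have a common upper bound
  \<open>y\<close>, so \<open>n x \<le> y\<close> for all \<open>n\<close>, and the Archimedean property of \<open>r\<close> gives \<open>x \<le> 0\<close>.
  The element \<open>-x\<close> is torsion as well, so also \<open>-x \<le> 0\<close>, and therefore \<open>x = 0\<close>. It remains to
  see that the Archimedean order is directed upwards in each case.

  An upper envelope \<open>w\<close> of \<open>x\<close> and \<open>y\<close> is above \<open>x\<close> in the specific order and above \<open>y\<close> in
  the other one. If one cone contains the other, the order with the smaller cone implies the order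
  with the larger cone, and then \<open>w\<close> is a common upper bound in the latter, which is the order
  assumed to be Archimedean. If instead \<open>F\<close>, the intersection of both cones, is generating, write
  \<open>x = u - v\<close> and \<open>y = u' - v'\<close> with entries in \<open>F\<close>; then \<open>u + u'\<close> bounds \<open>x\<close> and \<open>y\<close> from
  above in both orders.\<close>

definition upward_directed :: "('a \<Rightarrow> 'a \<Rightarrow> bool) \<Rightarrow> bool" where
  "upward_directed r \<longleftrightarrow> (\<forall>x y. \<exists>w. r x w \<and> r y w)"

lemma nmult_0 [simp]: "nmult 0 x = 0"
  by (simp add: nmult_def)

lemma nmult_Suc [simp]: "nmult (Suc n) x = nmult n x + x"
  by (simp add: nmult_def)

lemma nmult_add: "nmult (m + n) x = nmult m x + nmult n x"
  by (induction n) (simp_all add: algebra_simps)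

lemma nmult_minus: "nmult n (- x) = - nmult n x"
  by (simp add: nmult_def sum_negf)

lemma has_finite_order_minus: "has_finite_order x \<Longrightarrow> has_finite_order (- x)"
  by (auto simp: has_finite_order_def nmult_minus)

lemma nmult_mod:
  assumes "nmult N x = 0"
  shows "nmult (n mod N) x = nmult n x"
proof -
  have zero: "nmult (k * N) x = 0" for k
    by (induction k) (simp_all add: nmult_add assms)
  have "nmult n x = nmult (n div N * N) x + nmult (n mod N) x"
    by (metis div_mult_mod_eq nmult_add)
  then show ?thesis
    by (simp add: zero)
qed

lemma cone_iff_order:
  assumes "group_partial_order r"
  shows "v - u \<in> positive_cone r \<longleftrightarrow> r u v"
proof -
  have add: "r (a + w) (b + w)" if "r a b" for a b w
    using assms that by (simp add: group_partial_order_def)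
  show ?thesis
    using add[of 0 "v - u" u] add[of u v "- u"] by (auto simp: positive_cone_def)
qed

lemma order_mono_cone:
  assumes "group_partial_order r" "group_partial_order s"
    and "positive_cone r \<subseteq> positive_cone s" "r u v"
  shows "s u v"
  using assms by (metis cone_iff_order subsetD)

lemma finite_upper_bound_if_directed:
  assumes "transp r" "upward_directed r" "finite A"
  shows "\<exists>y. \<forall>a\<in>A. r a y"
  using \<open>finite A\<close>
proof induction
  case empty
  then show ?case by simp
next
  case (insert b A)
  then obtain y where y: "\<forall>a\<in>A. r a y" by blast
  obtain w where "r b w" "r y w"
    using assms(2) by (auto simp: upward_directed_def)
  with y show ?case
    using transpD[OF assms(1)] by blast
qed

text \<open>By periodicity a common bound of the multiples below the period bounds all multiples.\<close>

lemma finite_order_le_zero: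
  assumes "transp r" "upward_directed r" "archimedean r" "has_finite_order x"
  shows "r x 0"
proof -
  obtain N where N: "N \<ge> 1" "nmult N x = 0"
    using assms(4) by (auto simp: has_finite_order_def)
  obtain y where y: "\<forall>a\<in>(\<lambda>n. nmult n x) ` {..<N}. r a y"
    using finite_upper_bound_if_directed[OF assms(1,2)] by blast
  have "r (nmult n x) y" for n
  proof -
    have "r (nmult (n mod N) x) y"
      using y N(1) by simp
    then show ?thesis
      by (simp add: nmult_mod[OF N(2)])
  qed
  then show ?thesis
    using assms(3) by (auto simp: archimedean_def)
qed

text \<open>Applying the bound to the torsion elements \<open>x\<close> and \<open>-x\<close> squeezes \<open>x\<close> to zero.\<close>

lemma torsion_free_if_directed_archimedean:
  fixes r :: "'a::ab_group_add \<Rightarrow> 'a \<Rightarrow> bool" and x :: 'a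
  assumes r: "group_partial_order r" and dir: "upward_directed r" "archimedean r"
    and x: "has_finite_order x"
  shows "x = 0"
proof -
  have trans: "transp r" and antisym: "antisymp r"
    using r by (simp_all add: group_partial_order_def)
  have upper: "r x 0"
    using finite_order_le_zero[OF trans dir x] .
  have "r (- x) 0"
    using finite_order_le_zero[OF trans dir has_finite_order_minus[OF x]] .
  then have "r 0 x"
    using cone_iff_order[OF r, of 0 "- x"] cone_iff_order[OF r, of x 0] by simp
  with upper show ?thesis
    using antisympD[OF antisym] by blast
qed

lemma upward_directed_if_generating:
  fixes r :: "'a::ab_group_add \<Rightarrow> 'a \<Rightarrow> bool"
  assumes r: "group_partial_order r" and "generating F" and F: "F \<subseteq> positive_cone r"
  shows "upward_directed r"
  unfolding upward_directed_def
proof (intro allI)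
  fix x y :: 'a
  have decomposition: "\<exists>u v. u \<in> F \<and> v \<in> F \<and> z = u - v" for z :: 'a
    using assms(2) unfolding generating_def by blast
  have add: "a + b \<in> positive_cone r"
    if "a \<in> positive_cone r" "b \<in> positive_cone r" for a b
  proof -
    have "r 0 b" "r b (a + b)"
      using that cone_iff_order[OF r, of b 0] cone_iff_order[OF r, of "a + b" b] by simp_all
    then have "r 0 (a + b)"
      using r by (metis group_partial_order_def transpD)
    then show ?thesis
      by (simp add: positive_cone_def)
  qed
  obtain u v u' v' where uv: "u \<in> F" "v \<in> F" "u' \<in> F" "v' \<in> F"
    and xy: "x = u - v" "y = u' - v'"
    using decomposition by metis
  \<comment> \<open>These are the differences of \<open>u + u'\<close> with \<open>x\<close> and with \<open>y\<close>.\<close>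
  have "v + u' \<in> positive_cone r" "u + v' \<in> positive_cone r"
    using uv F add by auto
  then have "r x (u + u')" "r y (u + u')"
    using cone_iff_order[OF r, of "u + u'" x] cone_iff_order[OF r, of "u + u'" y]
    by (simp_all add: xy algebra_simps)
  then show "\<exists>w. r x w \<and> r y w" by blast
qed

theorem corollary4p5:
  fixes le sle :: "'a::ab_group_add \<Rightarrow> 'a \<Rightarrow> bool"
  assumes "mixed_lattice_group le sle"
    and "(positive_cone sle \<subseteq> positive_cone le \<and> archimedean le)
       \<or> (positive_cone le \<subseteq> positive_cone sle \<and> archimedean sle)
       \<or> ((archimedean le \<or> archimedean sle)
           \<and> generating (positive_cone sle \<inter> positive_cone le))"
  shows "\<not> (\<exists>x::'a. x \<noteq> 0 \<and> has_finite_order x)"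
proof -
  interpret mixed_lattice_group le sle by fact
  have mixed_bound: "\<exists>w. sle x w \<and> le y w" for x y
    using upper_envelope_exists[of x y] by (auto simp: is_minimum_def)
  have "(upward_directed le \<and> archimedean le) \<or> (upward_directed sle \<and> archimedean sle)"
    using assms(2)
  proof (elim disjE conjE)
    assume "positive_cone sle \<subseteq> positive_cone le" "archimedean le"
    then show ?thesis
      using mixed_bound order_mono_cone[OF sle_order le_order]
      unfolding upward_directed_def by meson
  next
    assume "positive_cone le \<subseteq> positive_cone sle" "archimedean sle"
    then show ?thesis
      using mixed_bound order_mono_cone[OF le_order sle_order]
      unfolding upward_directed_def by meson
  next
    assume "generating (positive_cone sle \<inter> positive_cone le)" "archimedean le"
    then show ?thesis
      using upward_directed_if_generating[OF le_order] by blast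
  next
    assume "generating (positive_cone sle \<inter> positive_cone le)" "archimedean sle"
    then show ?thesis
      using upward_directed_if_generating[OF sle_order] by blast
  qed
  then show ?thesis
    using torsion_free_if_directed_archimedean le_order sle_order by blast
qed

end
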